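(* Let $\epsilon\in(2/5,1]$. If $H$ is a graph having a vertex whose removal results in a bipartite graph $B$ with $\mathrm{ex}(n,B)=O(n^{2-\epsilon})$, then there exist constants $\epsilon(H)>0$ and $C>0$ such that $\mathrm{sp}(m,H)\ge C m^{3/4+\epsilon(H)}$ for all $m\ge1$.
   Context: For a graph $G$ with $m$ edges, $\mathrm{sp}(G)=\mathrm{mc}(G)-m/2$, where $\mathrm{mc}(G)$ is the maximum number of edges crossing a bipartition of $V(G)$. $\mathrm{sp}(m,H)$ is the minimum of $\mathrm{sp}(G)$ over all $H$-free graphs $G$ with $m$ edges. $\mathrm{ex}(n,F)$ is the maximum number of edges of an $n$-vertex $F$-free graph. *)

theory Defs
  imports Complex_Main "HOL-Library.Landau_Symbols" "HOL-Library.Extended_Real"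
begin

record 'a ugraph =
  verts :: "'a set"
  edges :: "'a set set"

definition fin_graph :: "'a ugraph \<Rightarrow> bool" where
  "fin_graph G \<longleftrightarrow> finite (verts G) \<and> (\<forall>e\<in>edges G. e \<subseteq> verts G \<and> card e = 2)"

definition del_vert :: "'a ugraph \<Rightarrow> 'a \<Rightarrow> 'a ugraph" where
  "del_vert G v = \<lparr>verts = verts G - {v}, edges = {e \<in> edges G. v \<notin> e}\<rparr>"

text \<open>The bipartition is \<open>(A, verts G - A)\<close>.\<close>

definition cut_edges :: "'a ugraph \<Rightarrow> 'a set \<Rightarrow> 'a set set" where
  "cut_edges G A = {e \<in> edges G. e \<inter> A \<noteq> {} \<and> e \<inter> (verts G - A) \<noteq> {}}"

definition bipartite :: "'a ugraph \<Rightarrow> bool" where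
  "bipartite G \<longleftrightarrow> (\<exists>A\<subseteq>verts G. cut_edges G A = edges G)"

text \<open>Subgraph containment in the usual, not necessarily induced, sense.\<close>

definition has_copy :: "'b ugraph \<Rightarrow> 'a ugraph \<Rightarrow> bool" where
  "has_copy G F \<longleftrightarrow> (\<exists>f. inj_on f (verts F) \<and> f ` verts F \<subseteq> verts G \<and>
                       (\<forall>e\<in>edges F. f ` e \<in> edges G))"

text \<open>Host graphs have natural numbers as vertices; every finite graph is isomorphic to such a
  graph, so no generality is lost in the two extremal quantities below.

  In \<open>ex_num\<close> the supremum over \<^typ>\<open>nat\<close> is a maximum, except that it is 0 when no
  \<open>n\<close>-vertex \<open>F\<close>-free graph exists (\<open>F\<close> edgeless with at most \<open>n\<close> vertices).\<close>

definition ex_num :: "nat \<Rightarrow> 'a ugraph \<Rightarrow> nat" where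
  "ex_num n F = Sup {card (edges G) | G :: nat ugraph.
                       fin_graph G \<and> card (verts G) = n \<and> \<not> has_copy G F}"

definition mc :: "'a ugraph \<Rightarrow> nat" where
  "mc G = Max {card (cut_edges G A) | A. A \<subseteq> verts G}"

definition sp :: "'a ugraph \<Rightarrow> real" where
  "sp G = real (mc G) - real (card (edges G)) / 2"

text \<open>Extended reals are used only so that the minimum over the empty set is \<open>\<infinity>\<close>, when no
  \<open>H\<close>-free graph with \<open>m\<close> edges exists (e.g.\ \<open>H\<close> a single edge); otherwise the infimum is
  attained, see \<open>sp_min_attained\<close>.\<close>

definition sp_min :: "nat \<Rightarrow> 'a ugraph \<Rightarrow> ereal" where
  "sp_min m H = Inf {ereal (sp G) | G :: nat ugraph.
                       fin_graph G \<and> card (edges G) = m \<and> \<not> has_copy G H}"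

lemma finite_edges: "fin_graph G \<Longrightarrow> finite (edges G)"
  unfolding fin_graph_def by (rule finite_subset[of _ "Pow (verts G)"]) auto

lemma mc_le: assumes "fin_graph G" shows "mc G \<le> card (edges G)"
proof -
  have fin: "finite {card (cut_edges G A) | A. A \<subseteq> verts G}"
    using assms by (simp add: fin_graph_def)
  have "card (cut_edges G A) \<le> card (edges G)" for A
    by (rule card_mono[OF finite_edges[OF assms]]) (auto simp: cut_edges_def)
  then show ?thesis
    unfolding mc_def by (subst Max_le_iff[OF fin]) auto
qed

lemma sp_min_attained:
  fixes G0 :: "nat ugraph"
  assumes "fin_graph G0" "card (edges G0) = m" "\<not> has_copy G0 H"
  obtains G :: "nat ugraph" where "fin_graph G" "card (edges G) = m" "\<not> has_copy G H"
    "sp_min m H = ereal (sp G)"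
proof -
  define S where "S = {ereal (sp G) | G :: nat ugraph.
                       fin_graph G \<and> card (edges G) = m \<and> \<not> has_copy G H}"
  have "S \<subseteq> (\<lambda>k. ereal (real k - real m / 2)) ` {..m}"
    using mc_le by (fastforce simp: S_def sp_def)
  then have "finite S" by (rule finite_subset) simp
  moreover have "S \<noteq> {}" using assms by (auto simp: S_def)
  ultimately have "Inf S \<in> S" by (metis Min_Inf Min_in)
  then show thesis using that by (auto simp: S_def sp_min_def)
qed

end

theory Submission
  imports Defs
begin

text \<open>
  Rounding the coordinates of \<open>x \<in> [-1, 1]\<^sup>V\<close> one at a time gives
  \<open>sp G \<ge> - (\<Sum>uv \<in> E. x\<^sub>u x\<^sub>v) / 2\<close>, so it suffices to find bounded random variables
  \<open>x\<^sub>v\<close> that are negatively correlated along edges; they are built from independent random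
  signs. The hypothesis on \<open>H\<close> enters only through the neighbourhoods: a set of \<open>d\<close>
  vertices inside a neighbourhood spans \<open>O(d powr (2 - \<epsilon>))\<close> edges, where we may assume
  \<open>\<epsilon> \<le> 1 / 2\<close>. Take \<open>D\<close> of order \<open>m powr (1 / (2 + \<epsilon>))\<close>.

  If every subgraph has a vertex of degree less than \<open>D\<close>, order the vertices so that each has fewer
  than \<open>D\<close> earlier neighbours, and let \<open>x\<^sub>v\<close> be its own sign corrected by a clipped
  multiple, of order \<open>D powr (\<epsilon> - 1)\<close>, of the sum of the signs of its earlier neighbours.
  The correction gains this order on every edge, and the loss comes from triangles only; the
  surplus is of order \<open>m D powr (\<epsilon> - 1)\<close>.

  Otherwise some subgraph on at most \<open>2 m / D\<close> vertices has minimum degree at least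
  \<open>D\<close>. A maximal family of disjoint sets of size about \<open>D / 2\<close>, each inside a
  neighbourhood, spans a subgraph of minimum degree at least \<open>D / 2\<close>. Give each of the
  \<open>k\<close> sets a random sign and subtract the mean of all signs: edges between different sets
  gain \<open>1 / k\<close> up to a constant factor, the few edges inside the sets do little harm, and the
  surplus is of order \<open>D\<^sup>2\<close>. Both orders are at least
  \<open>m powr ((1 + 2 * \<epsilon>) / (2 + \<epsilon>))\<close>, whose exponent exceeds \<open>3 / 4\<close>
  exactly when \<open>\<epsilon> > 2 / 5\<close>.
\<close>

subsection \<open>Averages over random signs\<close>

definition sg :: "'a set \<Rightarrow> 'a \<Rightarrow> real" where
  "sg A x = (if x \<in> A then 1 else -1)"

definition ssum :: "'a set \<Rightarrow> 'a set \<Rightarrow> real" where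
  "ssum N A = (\<Sum>x\<in>N. sg A x)"

text \<open>The expectation over a uniformly random subset of \<open>X\<close>, that is, over independent signs
  \<^term>\<open>sg A x\<close>.\<close>

definition avg :: "'a set \<Rightarrow> ('a set \<Rightarrow> real) \<Rightarrow> real" where
  "avg X f = (\<Sum>A\<in>Pow X. f A) / 2 ^ card X"

lemma avg_insert:
  assumes "finite X" "a \<notin> X"
  shows "avg (insert a X) f = (avg X f + avg X (\<lambda>A. f (insert a A))) / 2"
proof -
  have "(\<Sum>A\<in>Pow (insert a X). f A) = (\<Sum>A\<in>Pow X. f A) + (\<Sum>A\<in>insert a ` Pow X. f A)"
    unfolding Pow_insert using assms by (intro sum.union_disjoint) auto
  also have "(\<Sum>A\<in>insert a ` Pow X. f A) = (\<Sum>A\<in>Pow X. f (insert a A))"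
    using assms by (subst sum.reindex) (auto simp: inj_on_def)
  finally show ?thesis
    using assms by (simp add: avg_def add_divide_distrib)
qed

lemma avg_cong: "(\<And>A. A \<subseteq> X \<Longrightarrow> f A = g A) \<Longrightarrow> avg X f = avg X g"
  by (simp add: avg_def)

lemma avg_mono: "(\<And>A. A \<subseteq> X \<Longrightarrow> f A \<le> g A) \<Longrightarrow> avg X f \<le> avg X g"
  by (auto simp: avg_def intro!: divide_right_mono sum_mono)

lemma avg_const: "finite X \<Longrightarrow> avg X (\<lambda>A. c) = c"
  by (simp add: avg_def card_Pow)

lemma avg_add: "avg X (\<lambda>A. f A + g A) = avg X f + avg X g"
  by (simp add: avg_def sum.distrib add_divide_distrib)

lemma avg_diff: "avg X (\<lambda>A. f A - g A) = avg X f - avg X g"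
  by (simp add: avg_def sum_subtractf diff_divide_distrib)

lemma avg_cmult: "avg X (\<lambda>A. c * f A) = c * avg X f"
  by (simp add: avg_def sum_distrib_left[symmetric])

lemma avg_multc: "avg X (\<lambda>A. f A * c) = avg X f * c"
  by (simp add: avg_def sum_distrib_right[symmetric])

lemma avg_divide: "avg X (\<lambda>A. f A / c) = avg X f / c"
  using avg_multc[of X f "1 / c"] by simp

lemma avg_sum: "avg X (\<lambda>A. \<Sum>i\<in>I. f i A) = (\<Sum>i\<in>I. avg X (f i))"
  unfolding avg_def by (subst sum.swap) (simp add: sum_divide_distrib)

lemma avg_Un:
  assumes "finite X" "finite Y" "X \<inter> Y = {}"
  shows "avg (X \<union> Y) f = avg X (\<lambda>A. avg Y (\<lambda>B. f (A \<union> B)))"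
  using assms(2,3)
proof (induction Y arbitrary: f rule: finite_induct)
  case empty
  then show ?case by (simp add: avg_def)
next
  case (insert a Y)
  have "avg (X \<union> insert a Y) f = (avg (X \<union> Y) f + avg (X \<union> Y) (\<lambda>A. f (insert a A))) / 2"
    using insert assms(1) by (simp add: avg_insert)
  also have "\<dots> = (avg X (\<lambda>A. avg Y (\<lambda>B. f (A \<union> B)))
      + avg X (\<lambda>A. avg Y (\<lambda>B. f (insert a (A \<union> B))))) / 2"
    using insert.prems by (simp add: insert.IH)
  also have "\<dots> = avg X (\<lambda>A. (1/2) * (avg Y (\<lambda>B. f (A \<union> B)) + avg Y (\<lambda>B. f (insert a (A \<union> B)))))"
    by (simp only: avg_cmult avg_add)
  also have "\<dots> = avg X (\<lambda>A. avg (insert a Y) (\<lambda>B. f (A \<union> B)))"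
    using insert.hyps by (simp add: avg_insert)
  finally show ?case .
qed

lemma avg_restrict:
  assumes "finite Y" "X \<subseteq> Y" "\<And>A. A \<subseteq> Y \<Longrightarrow> f (A \<inter> X) = f A"
  shows "avg Y f = avg X f"
proof -
  have fin: "finite X" "finite (Y - X)" and Y: "Y = X \<union> (Y - X)"
    using assms finite_subset by auto
  have "avg Y f = avg X (\<lambda>A. avg (Y - X) (\<lambda>B. f (A \<union> B)))"
    by (subst Y, rule avg_Un) (use fin in auto)
  also have "\<dots> = avg X (\<lambda>A. avg (Y - X) (\<lambda>B. f A))"
  proof (intro avg_cong)
    fix A B assume "A \<subseteq> X" "B \<subseteq> Y - X"
    then have "(A \<union> B) \<inter> X = A" "A \<union> B \<subseteq> Y" using assms(2) by auto
    then show "f (A \<union> B) = f A" using assms(3) by metis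
  qed
  finally show ?thesis using fin by (simp add: avg_const)
qed

lemma avg_compl: "avg X f = avg X (\<lambda>A. f (X - A))"
  unfolding avg_def
  by (intro arg_cong2[where f="(/)"] refl sum.reindex_bij_witness[of _ "\<lambda>A. X - A" "\<lambda>A. X - A"])
    (auto simp: double_diff)

lemma exists_le_avg:
  assumes "finite X"
  shows "\<exists>A\<subseteq>X. f A \<le> avg X f"
proof (rule ccontr)
  assume "\<not> ?thesis"
  then have *: "\<And>A. A \<in> Pow X \<Longrightarrow> avg X f < f A" by auto
  have "(\<Sum>A\<in>Pow X. avg X f) < (\<Sum>A\<in>Pow X. f A)"
    by (rule sum_strict_mono) (use assms * in auto)
  then show False by (simp add: avg_def card_Pow assms)
qed

text \<open>Pairing each set without \<open>x\<close> with its extension by \<open>x\<close> leaves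
  half the discrete derivative of \<open>f\<close> in the sign of \<open>x\<close>.\<close>

lemma avg_sg_mult:
  assumes "finite X" "x \<in> X"
  shows "avg X (\<lambda>A. sg A x * f A) = avg (X - {x}) (\<lambda>A. (f (insert x A) - f A) / 2)"
proof -
  have "avg X (\<lambda>A. sg A x * f A) = avg (insert x (X - {x})) (\<lambda>A. sg A x * f A)"
    using assms by (simp add: insert_absorb)
  also have "\<dots> = (avg (X - {x}) (\<lambda>A. sg A x * f A)
      + avg (X - {x}) (\<lambda>A. sg (insert x A) x * f (insert x A))) / 2"
    using assms by (intro avg_insert) auto
  also have "avg (X - {x}) (\<lambda>A. sg A x * f A) = avg (X - {x}) (\<lambda>A. - 1 * f A)"
    by (intro avg_cong) (auto simp: sg_def)
  also have "\<dots> = - avg (X - {x}) f" by (simp only: avg_cmult)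
  finally show ?thesis
    by (simp add: sg_def avg_diff avg_divide diff_divide_distrib)
qed

lemma avg_sg_mult_0:
  assumes "finite X" "x \<in> X" "\<And>A. A \<subseteq> X \<Longrightarrow> f (insert x A) = f A"
  shows "avg X (\<lambda>A. sg A x * f A) = 0"
proof -
  have "avg X (\<lambda>A. sg A x * f A) = avg (X - {x}) (\<lambda>A. 0)"
    unfolding avg_sg_mult[OF assms(1,2)] by (intro avg_cong) (use assms(3) in auto)
  then show ?thesis by (simp add: avg_def)
qed

lemma avg_sg_sg:
  assumes "finite X" "x \<in> X"
  shows "avg X (\<lambda>A. sg A x * sg A y) = (if x = y then 1 else 0)"
proof (cases "x = y")
  case True
  have "avg X (\<lambda>A. sg A x * sg A y) = avg X (\<lambda>A. 1)"
    by (intro avg_cong) (simp add: sg_def True)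
  then show ?thesis using assms True by (simp add: avg_const)
next
  case False
  then show ?thesis using assms by (subst avg_sg_mult_0) (auto simp: sg_def)
qed

lemma avg_sg_ssum:
  assumes "finite X" "N \<subseteq> X" "x \<in> N"
  shows "avg X (\<lambda>A. sg A x * ssum N A) = 1"
proof -
  have "finite N" using assms finite_subset by blast
  have "avg X (\<lambda>A. sg A x * ssum N A) = (\<Sum>y\<in>N. avg X (\<lambda>A. sg A x * sg A y))"
    by (simp add: ssum_def sum_distrib_left avg_sum)
  also have "\<dots> = (\<Sum>y\<in>N. if x = y then 1 else 0)"
    using assms by (intro sum.cong refl avg_sg_sg) auto
  finally show ?thesis using assms \<open>finite N\<close> by simp
qed

lemma avg_ssum_square:
  assumes "finite X"
  shows "avg X (\<lambda>A. (ssum X A)\<^sup>2) = card X"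
proof -
  have "avg X (\<lambda>A. (ssum X A)\<^sup>2) = avg X (\<lambda>A. \<Sum>x\<in>X. sg A x * ssum X A)"
    by (intro avg_cong) (simp add: power2_eq_square ssum_def sum_distrib_right)
  also have "\<dots> = (\<Sum>x\<in>X. 1)"
    unfolding avg_sum by (intro sum.cong refl avg_sg_ssum assms) auto
  finally show ?thesis by simp
qed

lemma ssum_cong: "A \<inter> N = B \<inter> N \<Longrightarrow> ssum N A = ssum N B"
  unfolding ssum_def sg_def by (intro sum.cong) auto

lemma ssum_compl: "A \<subseteq> X \<Longrightarrow> ssum X (X - A) = - ssum X A"
  unfolding ssum_def sg_def sum_negf[symmetric] by (intro sum.cong) auto

lemma ssum_Un: "finite M \<Longrightarrow> finite N \<Longrightarrow> M \<inter> N = {} \<Longrightarrow> ssum (M \<union> N) A = ssum M A + ssum N A"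
  unfolding ssum_def by (rule sum.union_disjoint)

section \<open>Clipped sums of random signs\<close>

definition clip :: "real \<Rightarrow> real" where
  "clip t = max (-1) (min 1 t)"

lemma clip_minus: "clip (- t) = - clip t"
  by (simp add: clip_def max_def min_def)

lemma abs_clip_le: "\<bar>clip t\<bar> \<le> 1"
  by (simp add: clip_def)

lemma abs_clip_diff_le: "\<bar>clip s - clip t\<bar> \<le> \<bar>s - t\<bar>"
  by (simp add: clip_def max_def min_def)

text \<open>Taking complements flips every sign, and clipping is odd, so the average equals its own
  negative.\<close>

lemma avg_clip_ssum:
  assumes "finite X"
  shows "avg X (\<lambda>A. clip (\<gamma> * ssum X A)) = 0"
proof -
  have "avg X (\<lambda>A. clip (\<gamma> * ssum X A)) = avg X (\<lambda>A. -1 * clip (\<gamma> * ssum X A))"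
    by (subst avg_compl, intro avg_cong) (simp add: ssum_compl flip: clip_minus)
  then show ?thesis unfolding avg_cmult by simp
qed

lemma abs_avg_clip_shift_le:
  assumes "finite X" "\<gamma> \<ge> 0"
  shows "\<bar>avg X (\<lambda>A. clip (\<gamma> * (t + ssum X A)))\<bar> \<le> \<gamma> * \<bar>t\<bar>"
proof -
  have *: "\<bar>clip (\<gamma> * (t + y)) - clip (\<gamma> * y)\<bar> \<le> \<gamma> * \<bar>t\<bar>" for y
    using abs_clip_diff_le[of "\<gamma> * (t + y)" "\<gamma> * y"] assms(2)
    by (simp add: algebra_simps abs_mult)
  let ?d = "\<lambda>A. clip (\<gamma> * (t + ssum X A)) - clip (\<gamma> * ssum X A)"
  have "avg X (\<lambda>A. clip (\<gamma> * (t + ssum X A))) = avg X ?d"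
    using assms by (simp add: avg_diff avg_clip_ssum)
  moreover have "avg X ?d \<le> avg X (\<lambda>A. \<gamma> * \<bar>t\<bar>)"
    by (intro avg_mono) (use * abs_le_D1 in blast)
  moreover have "avg X (\<lambda>A. - (\<gamma> * \<bar>t\<bar>)) \<le> avg X ?d"
  proof (intro avg_mono)
    fix A show "- (\<gamma> * \<bar>t\<bar>) \<le> ?d A" using *[of "ssum X A"] by linarith
  qed
  ultimately show ?thesis using assms by (simp add: avg_const)
qed

text \<open>Conditioned on the signs in \<open>M \<inter> N\<close>, the two factors are independent, and each has
  conditional mean at most \<open>\<gamma> \<bar>ssum (M \<inter> N) A\<bar>\<close> in absolute value, since clipping is odd and
  1-Lipschitz.\<close>

lemma avg_clip_mult_clip_le:
  assumes "finite V" "M \<subseteq> V" "N \<subseteq> V" "\<gamma> \<ge> 0"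
  shows "avg V (\<lambda>A. clip (\<gamma> * ssum M A) * clip (\<gamma> * ssum N A)) \<le> \<gamma>\<^sup>2 * card (M \<inter> N)"
proof -
  define P Q R where "P = M \<inter> N" and "Q = M - N" and "R = N - M"
  have fin: "finite P" "finite Q" "finite R"
    using assms finite_subset unfolding P_def Q_def R_def by blast+
  have disj: "P \<inter> Q = {}" "P \<inter> R = {}" "Q \<inter> R = {}" and M: "M = P \<union> Q" and N: "N = P \<union> R"
    by (auto simp: P_def Q_def R_def)
  let ?f = "\<lambda>A. clip (\<gamma> * ssum M A) * clip (\<gamma> * ssum N A)"
  let ?h = "\<lambda>X t. avg X (\<lambda>A. clip (\<gamma> * (t + ssum X A)))"
  have "avg V ?f = avg (P \<union> (Q \<union> R)) ?f"
  proof (intro avg_restrict)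
    fix A
    have "ssum M (A \<inter> (P \<union> (Q \<union> R))) = ssum M A" "ssum N (A \<inter> (P \<union> (Q \<union> R))) = ssum N A"
      by (rule ssum_cong, auto simp: M N)+
    then show "?f (A \<inter> (P \<union> (Q \<union> R))) = ?f A" by simp
  qed (use assms in \<open>auto simp: M N\<close>)
  also have "\<dots> = avg P (\<lambda>A. avg (Q \<union> R) (\<lambda>B. ?f (A \<union> B)))"
    using fin disj by (intro avg_Un) auto
  also have "\<dots> = avg P (\<lambda>A. avg Q (\<lambda>B. avg R (\<lambda>C. ?f (A \<union> (B \<union> C)))))"
    using fin disj by (simp add: avg_Un)
  also have "\<dots> = avg P (\<lambda>A. avg Q (\<lambda>B. avg R (\<lambda>C.
      clip (\<gamma> * (ssum P A + ssum Q B)) * clip (\<gamma> * (ssum P A + ssum R C)))))"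
  proof (intro avg_cong)
    fix A B C assume "A \<subseteq> P" "B \<subseteq> Q" "C \<subseteq> R"
    then have "ssum P (A \<union> (B \<union> C)) = ssum P A" "ssum Q (A \<union> (B \<union> C)) = ssum Q B"
      "ssum R (A \<union> (B \<union> C)) = ssum R C"
      using disj by (auto intro!: ssum_cong)
    then show "?f (A \<union> (B \<union> C)) = clip (\<gamma> * (ssum P A + ssum Q B)) * clip (\<gamma> * (ssum P A + ssum R C))"
      by (simp add: M N ssum_Un fin disj)
  qed
  also have "\<dots> = avg P (\<lambda>A. ?h R (ssum P A) * ?h Q (ssum P A))"
    by (simp add: avg_cmult avg_multc mult.commute)
  also have "\<dots> \<le> avg P (\<lambda>A. \<gamma>\<^sup>2 * (ssum P A)\<^sup>2)"
  proof (intro avg_mono)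
    fix A
    let ?t = "ssum P A"
    have "?h R ?t * ?h Q ?t \<le> \<bar>?h R ?t\<bar> * \<bar>?h Q ?t\<bar>"
      by (metis abs_ge_self abs_mult)
    also have "\<dots> \<le> (\<gamma> * \<bar>?t\<bar>) * (\<gamma> * \<bar>?t\<bar>)"
      using assms fin by (intro mult_mono abs_avg_clip_shift_le) auto
    also have "\<dots> = \<gamma>\<^sup>2 * ?t\<^sup>2"
      by (simp add: power2_eq_square)
    finally show "?h R ?t * ?h Q ?t \<le> \<gamma>\<^sup>2 * ?t\<^sup>2" .
  qed
  also have "\<dots> = \<gamma>\<^sup>2 * card P"
    using fin by (simp add: avg_cmult avg_ssum_square)
  finally show ?thesis by (simp add: P_def)
qed

text \<open>If \<bar>\<gamma> t\<bar> \<le> 1/2, nothing is clipped and the right side is exactly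
  \<gamma>. Otherwise 4 \<gamma>^2 t^2 \<ge> 1, so the left side is at most 0, and the right side is
  nonnegative by monotonicity. Because the lower bound is quadratic in t, averaging it needs only a
  second moment.\<close>

lemma clip_increment_ge:
  fixes \<gamma> :: real
  assumes "0 < \<gamma>" "\<gamma> \<le> 1 / 2"
  shows "\<gamma> * (1 - 4 * \<gamma>\<^sup>2 * t\<^sup>2) \<le> (clip (\<gamma> * (t + 1)) - clip (\<gamma> * (t - 1))) / 2"
proof (cases "\<bar>\<gamma> * t\<bar> \<le> 1 / 2")
  case True
  then have "clip (\<gamma> * (t + 1)) = \<gamma> * (t + 1)" "clip (\<gamma> * (t - 1)) = \<gamma> * (t - 1)"
    using assms by (auto simp: clip_def algebra_simps)
  moreover have "\<gamma> * (1 - 4 * \<gamma>\<^sup>2 * t\<^sup>2) \<le> \<gamma> * 1"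
    using assms by (intro mult_left_mono) auto
  ultimately show ?thesis by (simp add: algebra_simps)
next
  case False
  then have "(1 / 2)\<^sup>2 \<le> \<bar>\<gamma> * t\<bar>\<^sup>2" by (intro power_mono) auto
  then have "\<gamma> * (1 - 4 * \<gamma>\<^sup>2 * t\<^sup>2) \<le> 0"
    using assms by (intro mult_nonneg_nonpos) (auto simp: power_mult_distrib power_divide)
  moreover have "clip (\<gamma> * (t - 1)) \<le> clip (\<gamma> * (t + 1))"
    unfolding clip_def using assms by (intro max.mono min.mono) (auto intro: mult_left_mono)
  ultimately show ?thesis by simp
qed

text \<open>The average is that of the discrete derivative of the clipped sum in the sign of
  \<open>u\<close>. With t the sum of the other signs, t^2 has mean \<open>card T\<close>, so the
  assumption on \<open>card N\<close> limits the expected loss from clipping to half of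
  \<gamma>.\<close>

lemma avg_sg_mult_clip_ge:
  fixes \<gamma> :: real
  assumes "finite V" "N \<subseteq> V" "u \<in> N" "0 < \<gamma>" "\<gamma> \<le> 1 / 2" "8 * \<gamma>\<^sup>2 * card N \<le> 1"
  shows "\<gamma> / 2 \<le> avg V (\<lambda>A. sg A u * clip (\<gamma> * ssum N A))"
proof -
  define T where "T = N - {u}"
  have finN: "finite N" using assms finite_subset by blast
  then have finT: "finite T" and cT: "card T \<le> card N"
    by (auto simp: T_def intro: card_mono)
  have N: "ssum N A = sg A u + ssum T A" for A
    unfolding ssum_def T_def using assms finN by (simp add: sum.remove)
  have "4 * \<gamma>\<^sup>2 * card T \<le> 4 * \<gamma>\<^sup>2 * card N"
    using cT by (intro mult_left_mono) auto
  then have "1 / 2 \<le> 1 - 4 * \<gamma>\<^sup>2 * card T"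
    using assms(6) by linarith
  then have "\<gamma> / 2 \<le> \<gamma> * (1 - 4 * \<gamma>\<^sup>2 * card T)"
    using assms mult_left_mono[of "1/2" _ \<gamma>] by simp
  also have "\<dots> = avg T (\<lambda>A. \<gamma> * (1 - 4 * \<gamma>\<^sup>2 * (ssum T A)\<^sup>2))"
    using finT by (simp add: avg_cmult avg_diff avg_const avg_ssum_square)
  also have "\<dots> \<le> avg T (\<lambda>A. (clip (\<gamma> * (ssum T A + 1)) - clip (\<gamma> * (ssum T A - 1))) / 2)"
    using assms by (intro avg_mono clip_increment_ge)
  also have "\<dots> = avg T (\<lambda>A. (clip (\<gamma> * ssum N (insert u A)) - clip (\<gamma> * ssum N A)) / 2)"
  proof (intro avg_cong)
    fix A assume "A \<subseteq> T"
    then have "ssum T (insert u A) = ssum T A" "sg A u = -1" "sg (insert u A) u = 1"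
      by (auto intro!: ssum_cong simp: sg_def T_def)
    then show "(clip (\<gamma> * (ssum T A + 1)) - clip (\<gamma> * (ssum T A - 1))) / 2
        = (clip (\<gamma> * ssum N (insert u A)) - clip (\<gamma> * ssum N A)) / 2"
      by (simp add: N algebra_simps)
  qed
  also have "\<dots> = avg N (\<lambda>A. sg A u * clip (\<gamma> * ssum N A))"
    unfolding T_def using assms finN by (simp add: avg_sg_mult)
  also have "\<dots> = avg V (\<lambda>A. sg A u * clip (\<gamma> * ssum N A))"
  proof (intro avg_restrict[symmetric] assms)
    fix A
    have "ssum N (A \<inter> N) = ssum N A" by (rule ssum_cong) auto
    then show "sg (A \<inter> N) u * clip (\<gamma> * ssum N (A \<inter> N)) = sg A u * clip (\<gamma> * ssum N A)"
      using assms(3) by (simp add: sg_def)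
  qed
  finally show ?thesis .
qed

text \<open>Here \<open>N w\<close> stands for the earlier neighbours of \<open>w\<close>, and
  \<open>u\<close> is earlier than \<open>v\<close>. Of the four terms of the product, sign times
  sign has mean 0, and so has the sign of \<open>v\<close> times the correction at \<open>u\<close>,
  which does not depend on that sign. The sign of \<open>u\<close> times the correction at
  \<open>v\<close> yields the gain, and the two corrections correlate only through common earlier
  neighbours.\<close>

lemma avg_orientation_edge_le:
  fixes N :: "'a \<Rightarrow> 'a set" and \<gamma> :: real
  assumes "finite V" "N u \<subseteq> V" "N v \<subseteq> V" "u \<in> N v" "v \<in> V" "u \<noteq> v" "v \<notin> N u"
    and "0 < \<gamma>" "\<gamma> \<le> 1 / 2" "8 * \<gamma>\<^sup>2 * card (N v) \<le> 1"
  defines "x \<equiv> \<lambda>A w. (sg A w - clip (\<gamma> * ssum (N w) A)) / 2"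
  shows "avg V (\<lambda>A. x A u * x A v) \<le> (\<gamma>\<^sup>2 * card (N u \<inter> N v) - \<gamma> / 2) / 4"
proof -
  let ?c = "\<lambda>A w. clip (\<gamma> * ssum (N w) A)"
  have "avg V (\<lambda>A. x A u * x A v) = avg V (\<lambda>A. (1/4) *
      (sg A u * sg A v + ?c A u * ?c A v - sg A u * ?c A v - sg A v * ?c A u))"
    by (intro avg_cong) (simp add: x_def field_simps)
  also have "\<dots> = (1/4) * (avg V (\<lambda>A. sg A u * sg A v) + avg V (\<lambda>A. ?c A u * ?c A v)
      - avg V (\<lambda>A. sg A u * ?c A v) - avg V (\<lambda>A. sg A v * ?c A u))"
    by (simp only: avg_cmult avg_add avg_diff)
  also have "avg V (\<lambda>A. sg A u * sg A v) = 0"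
    using assms by (subst avg_sg_sg) auto
  also have "avg V (\<lambda>A. sg A v * ?c A u) = 0"
  proof (rule avg_sg_mult_0)
    fix A show "?c (insert v A) u = ?c A u"
      using assms(7) by (subst ssum_cong[of _ _ A]) auto
  qed (use assms in auto)
  finally show ?thesis
    using avg_clip_mult_clip_le[of V "N u" "N v" \<gamma>] avg_sg_mult_clip_ge[of V "N v" u \<gamma>] assms
    by simp
qed

subsection \<open>Neighbourhoods and induced edges\<close>

definition nbhd :: "'a ugraph \<Rightarrow> 'a \<Rightarrow> 'a set" where
  "nbhd G v = {u. {u, v} \<in> edges G}"

definition edges_in :: "'a ugraph \<Rightarrow> 'a set \<Rightarrow> 'a set set" where
  "edges_in G U = {e \<in> edges G. e \<subseteq> U}"

lemma edgeE:
  assumes "fin_graph G" "e \<in> edges G"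
  obtains u v where "e = {u, v}" "u \<noteq> v" "u \<in> verts G" "v \<in> verts G"
proof -
  have "e \<subseteq> verts G" "card e = 2" using assms by (auto simp: fin_graph_def)
  then show thesis using that by (auto simp: card_2_iff)
qed

lemma nbhd_subset: "fin_graph G \<Longrightarrow> nbhd G v \<subseteq> verts G"
  by (auto simp: nbhd_def fin_graph_def)

lemma finite_nbhd: "fin_graph G \<Longrightarrow> finite (nbhd G v)"
  using nbhd_subset finite_subset unfolding fin_graph_def by metis

lemma not_in_nbhd: "fin_graph G \<Longrightarrow> v \<notin> nbhd G v"
  by (fastforce simp: nbhd_def fin_graph_def)

lemma nbhd_sym: "u \<in> nbhd G v \<longleftrightarrow> v \<in> nbhd G u"
  by (simp add: nbhd_def insert_commute)

lemma finite_edges_in: "fin_graph G \<Longrightarrow> finite (edges_in G U)"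
  unfolding edges_in_def by (simp add: finite_edges)

lemma finite_verts: "fin_graph G \<Longrightarrow> finite (verts G)"
  by (simp add: fin_graph_def)

lemma edges_in_verts: "fin_graph G \<Longrightarrow> edges_in G (verts G) = edges G"
  by (auto simp: edges_in_def fin_graph_def)

lemma card_edges_in_le: "fin_graph G \<Longrightarrow> card (edges_in G U) \<le> card (edges G)"
  by (intro card_mono finite_edges) (auto simp: edges_in_def)

subsection \<open>Surplus from bounded random variables\<close>

text \<open>A vertex occurs at most once in each product, so the sum is affine in every single
  coordinate and does not increase when that coordinate moves to the better end of [-1, 1].\<close>

lemma multilinear_rounding:
  fixes x :: "'a \<Rightarrow> real"
  assumes "finite E" "\<And>e. e \<in> E \<Longrightarrow> finite e" "finite S" "\<And>v. v \<in> S \<Longrightarrow> \<bar>x v\<bar> \<le> 1"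
  shows "\<exists>y. (\<forall>v\<in>S. \<bar>y v\<bar> = 1) \<and> (\<forall>v. v \<notin> S \<longrightarrow> y v = x v) \<and>
           (\<Sum>e\<in>E. \<Prod>w\<in>e. y w) \<le> (\<Sum>e\<in>E. \<Prod>w\<in>e. x w)"
  using assms(3,4)
proof (induction S rule: finite_induct)
  case empty
  then show ?case by auto
next
  case (insert v S)
  let ?F = "\<lambda>y. \<Sum>e\<in>E. \<Prod>w\<in>e. y w"
  obtain y where y: "\<forall>u\<in>S. \<bar>y u\<bar> = 1" "\<forall>u. u \<notin> S \<longrightarrow> y u = x u" "?F y \<le> ?F x"
    using insert.IH insert.prems by auto
  \<comment> \<open>As a function of the coordinate at \<open>v\<close> the sum is a + t b; the best
    t is -1 or 1, opposite in sign to b.\<close>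
  define a where "a = (\<Sum>e\<in>{e\<in>E. v \<notin> e}. \<Prod>w\<in>e. y w)"
  define b where "b = (\<Sum>e\<in>{e\<in>E. v \<in> e}. \<Prod>w\<in>e - {v}. y w)"
  have F: "?F (y(v := t)) = a + t * b" for t
  proof -
    have "?F (y(v := t)) = (\<Sum>e\<in>{e\<in>E. v \<notin> e} \<union> {e\<in>E. v \<in> e}. \<Prod>w\<in>e. (y(v := t)) w)"
      by (intro sum.cong) auto
    also have "\<dots> = (\<Sum>e\<in>{e\<in>E. v \<notin> e}. \<Prod>w\<in>e. (y(v := t)) w) + (\<Sum>e\<in>{e\<in>E. v \<in> e}. \<Prod>w\<in>e. (y(v := t)) w)"
      using assms(1) by (intro sum.union_disjoint) auto
    also have "(\<Sum>e\<in>{e\<in>E. v \<notin> e}. \<Prod>w\<in>e. (y(v := t)) w) = a"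
      unfolding a_def by (intro sum.cong prod.cong refl) auto
    also have "(\<Sum>e\<in>{e\<in>E. v \<in> e}. \<Prod>w\<in>e. (y(v := t)) w) = t * b"
      unfolding b_def sum_distrib_left
    proof (intro sum.cong refl)
      fix e assume "e \<in> {e\<in>E. v \<in> e}"
      then have "(\<Prod>w\<in>e. (y(v := t)) w) = t * (\<Prod>w\<in>e - {v}. (y(v := t)) w)"
        using assms(2) by (subst prod.remove[of e v]) auto
      also have "(\<Prod>w\<in>e - {v}. (y(v := t)) w) = (\<Prod>w\<in>e - {v}. y w)"
        by (intro prod.cong) auto
      finally show "(\<Prod>w\<in>e. (y(v := t)) w) = t * (\<Prod>w\<in>e - {v}. y w)" .
    qed
    finally show ?thesis .
  qed
  have yv: "y v = x v" "\<bar>x v\<bar> \<le> 1" using y insert by auto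
  have "- \<bar>b\<bar> \<le> y v * b"
  proof -
    have "\<bar>y v * b\<bar> \<le> 1 * \<bar>b\<bar>" unfolding abs_mult using yv by (intro mult_right_mono) auto
    then show ?thesis by linarith
  qed
  moreover define t where "t = (if b \<ge> 0 then -1 else 1 :: real)"
  moreover have "t * b = - \<bar>b\<bar>" by (simp add: t_def)
  ultimately have "?F (y(v := t)) \<le> ?F y"
    using F[of t] F[of "y v"] by simp
  moreover have "\<bar>t\<bar> = 1" by (simp add: t_def)
  ultimately show ?case
    using y yv insert.hyps by (intro exI[of _ "y(v := t)"]) auto
qed

text \<open>After rounding to signs, cut along the vertices of value 1. Crossing edges have product
  -1 and all others 1, so the sum is the number of edges minus twice the size of the cut.\<close>

lemma sp_ge_relaxation:
  assumes G: "fin_graph G" and x: "\<And>v. v \<in> verts G \<Longrightarrow> \<bar>x v\<bar> \<le> 1"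
  shows "sp G \<ge> - (\<Sum>e\<in>edges G. \<Prod>w\<in>e. x w) / 2"
proof -
  have fin: "finite (verts G)" "finite (edges G)" "\<And>e. e \<in> edges G \<Longrightarrow> finite e"
    using G finite_edges finite_subset by (auto simp: fin_graph_def intro: finite_edges)
  obtain y where y: "\<forall>v\<in>verts G. \<bar>y v\<bar> = 1"
      "(\<Sum>e\<in>edges G. \<Prod>w\<in>e. y w) \<le> (\<Sum>e\<in>edges G. \<Prod>w\<in>e. x w)"
    using multilinear_rounding[OF fin(2,3,1), of x] x by blast
  define A where "A = {v\<in>verts G. y v = 1}"
  have prod_y: "(\<Prod>w\<in>e. y w) = (if e \<in> cut_edges G A then -1 else 1)" if e: "e \<in> edges G" for e
  proof -
    obtain u v where uv: "e = {u, v}" "u \<noteq> v" "u \<in> verts G" "v \<in> verts G"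
      using edgeE[OF G e] .
    then have "y u = 1 \<or> y u = -1" "y v = 1 \<or> y v = -1" using y(1) by (auto simp: abs_if split: if_splits)
    then show ?thesis using uv e by (auto simp: cut_edges_def A_def)
  qed
  have sub: "cut_edges G A \<subseteq> edges G" by (auto simp: cut_edges_def)
  have "(\<Sum>e\<in>edges G. \<Prod>w\<in>e. y w) = (\<Sum>e\<in>edges G. 1 - (if e \<in> cut_edges G A then 2 else 0))"
    using prod_y by (intro sum.cong) auto
  also have "\<dots> = real (card (edges G)) - 2 * real (card (cut_edges G A))"
    using fin sub by (simp add: sum_subtractf sum.If_cases Int_absorb1)
  finally have *: "(\<Sum>e\<in>edges G. \<Prod>w\<in>e. y w) = real (card (edges G)) - 2 * real (card (cut_edges G A))" .
  have "card (cut_edges G A) \<le> mc G"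
    unfolding mc_def by (intro Max_ge) (use fin in \<open>auto simp: A_def\<close>)
  then show ?thesis using * y(2) by (simp add: sp_def)
qed

lemma sp_ge_avg_relaxation:
  assumes "fin_graph G" "finite X" "\<And>A v. A \<subseteq> X \<Longrightarrow> v \<in> verts G \<Longrightarrow> \<bar>x A v\<bar> \<le> 1"
  shows "sp G \<ge> - (\<Sum>e\<in>edges G. avg X (\<lambda>A. \<Prod>w\<in>e. x A w)) / 2"
proof -
  obtain A where A: "A \<subseteq> X" "(\<Sum>e\<in>edges G. \<Prod>w\<in>e. x A w) \<le> avg X (\<lambda>A. \<Sum>e\<in>edges G. \<Prod>w\<in>e. x A w)"
    using exists_le_avg[OF assms(2), of "\<lambda>A. \<Sum>e\<in>edges G. \<Prod>w\<in>e. x A w"] by blast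
  then show ?thesis
    using sp_ge_relaxation[of G "x A"] assms by (force simp: avg_sum)
qed

subsection \<open>Degenerate graphs\<close>

text \<open>Remove a vertex of small degree, rank the rest by induction and put the removed vertex
  last.\<close>

lemma exists_degenerate_rank:
  fixes D :: real
  assumes G: "fin_graph G"
    and deg: "\<And>W. W \<subseteq> verts G \<Longrightarrow> W \<noteq> {} \<Longrightarrow> \<exists>w\<in>W. card (nbhd G w \<inter> W) < D"
    and "W \<subseteq> verts G"
  shows "\<exists>r :: 'a \<Rightarrow> nat. inj_on r W \<and> (\<forall>v\<in>W. r v < card W) \<and>
           (\<forall>v\<in>W. card {u \<in> nbhd G v \<inter> W. r u < r v} < D)"
  using assms(3)
proof (induction "card W" arbitrary: W)
  case 0
  then have "W = {}" using finite_subset[OF _ finite_verts[OF G]] by auto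
  then show ?case by auto
next
  case (Suc n)
  then have finW: "finite W" and "W \<noteq> {}" using card_ge_0_finite[of W] by auto
  then obtain w where w: "w \<in> W" "card (nbhd G w \<inter> W) < D" using deg Suc.prems by blast
  have cW: "card (W - {w}) = n" using Suc.hyps(2) w finW by simp
  have "W - {w} \<subseteq> verts G" using Suc.prems by blast
  note IH = Suc.hyps(1)[OF cW[symmetric] this, unfolded cW]
  obtain r :: "'a \<Rightarrow> nat" where r: "inj_on r (W - {w})" "\<forall>v\<in>W - {w}. r v < n"
      "\<forall>v\<in>W - {w}. card {u \<in> nbhd G v \<inter> (W - {w}). r u < r v} < D"
    using IH by (elim exE conjE)
  let ?r = "r(w := n)"
  have "card {u \<in> nbhd G v \<inter> W. ?r u < ?r v} < D" if "v \<in> W" for v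
  proof (cases "v = w")
    case True
    have "card {u \<in> nbhd G v \<inter> W. ?r u < ?r v} \<le> card (nbhd G w \<inter> W)"
      using True finW by (intro card_mono) auto
    then show ?thesis using w(2) by linarith
  next
    case False
    then have "r v < n" using r(2) that by blast
    then have "{u \<in> nbhd G v \<inter> W. ?r u < ?r v} = {u \<in> nbhd G v \<inter> (W - {w}). r u < r v}"
      using False by auto
    then show ?thesis using r(3) that False by auto
  qed
  moreover have "inj_on ?r W"
    using r(1,2) by (auto simp: inj_on_def)
  moreover have "\<forall>v\<in>W. ?r v < card W"
  proof
    fix v assume v: "v \<in> W"
    have "v \<noteq> w \<Longrightarrow> r v < n" using r(2) v by blast
    then show "?r v < card W" unfolding Suc.hyps(2)[symmetric] by (cases "v = w") auto
  qed
  ultimately show ?case by blast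
qed

text \<open>Injectivity of the rank makes one endpoint of each edge strictly later, so each edge is
  counted once, at its later endpoint \<open>v\<close>.\<close>

lemma sum_edges_in_orientation:
  fixes r :: "'a \<Rightarrow> nat" and f :: "'a set \<Rightarrow> real"
  assumes G: "fin_graph G" and r: "inj_on r (verts G)" and U: "U \<subseteq> verts G"
  shows "(\<Sum>e\<in>edges_in G U. f e) = (\<Sum>v\<in>U. \<Sum>u\<in>{u \<in> nbhd G v. r u < r v} \<inter> U. f {u, v})"
proof -
  let ?N = "\<lambda>v. {u \<in> nbhd G v. r u < r v} \<inter> U"
  have fin: "finite U" using U finite_verts[OF G] finite_subset by blast
  have inj: "inj_on (\<lambda>(v, u). {u, v}) (Sigma U ?N)"
    by (auto simp: inj_on_def doubleton_eq_iff)
  have img: "edges_in G U = (\<lambda>(v, u). {u, v}) ` Sigma U ?N"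
  proof
    show "edges_in G U \<subseteq> (\<lambda>(v, u). {u, v}) ` Sigma U ?N"
    proof
      fix e assume e: "e \<in> edges_in G U"
      then obtain u v where uv: "e = {u, v}" "u \<noteq> v" "u \<in> verts G" "v \<in> verts G"
        using edgeE[OF G, of e] by (auto simp: edges_in_def)
      then have "r u \<noteq> r v" using r by (auto simp: inj_on_def)
      then consider "r u < r v" | "r v < r u" by linarith
      then show "e \<in> (\<lambda>(v, u). {u, v}) ` Sigma U ?N"
      proof cases
        case 1
        then show ?thesis using uv e by (intro image_eqI[of _ _ "(v, u)"]) (auto simp: edges_in_def nbhd_def)
      next
        case 2
        then show ?thesis using uv e
          by (intro image_eqI[of _ _ "(u, v)"]) (auto simp: edges_in_def nbhd_def insert_commute)
      qed
    qed
  qed (auto simp: edges_in_def nbhd_def)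
  show ?thesis
    unfolding img sum.reindex[OF inj]
    using fin by (subst sum.Sigma) (auto simp: split_def)
qed

lemma sum_degrees:
  assumes G: "fin_graph G" and U: "U \<subseteq> verts G"
  shows "(\<Sum>v\<in>U. card (nbhd G v \<inter> U)) = 2 * card (edges_in G U)"
proof -
  have fin: "finite U" using U finite_verts[OF G] finite_subset by blast
  have "(\<Sum>v\<in>U. card (nbhd G v \<inter> U)) = (\<Sum>v\<in>U. card {e \<in> edges_in G U. v \<in> e})"
  proof (intro sum.cong refl bij_betw_same_card)
    fix v assume v: "v \<in> U"
    show "bij_betw (\<lambda>u. {u, v}) (nbhd G v \<inter> U) {e \<in> edges_in G U. v \<in> e}"
      unfolding bij_betw_def
    proof
      show "inj_on (\<lambda>u. {u, v}) (nbhd G v \<inter> U)" by (auto simp: inj_on_def doubleton_eq_iff)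
      show "(\<lambda>u. {u, v}) ` (nbhd G v \<inter> U) = {e \<in> edges_in G U. v \<in> e}"
      proof
        show "{e \<in> edges_in G U. v \<in> e} \<subseteq> (\<lambda>u. {u, v}) ` (nbhd G v \<inter> U)"
        proof
          fix e assume e: "e \<in> {e \<in> edges_in G U. v \<in> e}"
          then have "e \<in> edges G" by (auto simp: edges_in_def)
          then obtain a b where ab: "e = {a, b}" "a \<noteq> b"
            using edgeE[OF G] by metis
          then have "e = {a, v} \<and> a \<in> U \<or> e = {b, v} \<and> b \<in> U"
            using e by (auto simp: edges_in_def)
          then show "e \<in> (\<lambda>u. {u, v}) ` (nbhd G v \<inter> U)"
            using e by (auto simp: edges_in_def nbhd_def)
        qed
      qed (use v in \<open>auto simp: edges_in_def nbhd_def\<close>)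
    qed
  qed
  also have "\<dots> = 2 * card (edges_in G U)"
  proof (rule sum_multicount[OF fin finite_edges_in[OF G]])
    show "\<forall>e\<in>edges_in G U. card {v \<in> U. v \<in> e} = 2"
    proof
      fix e assume e: "e \<in> edges_in G U"
      then have "{v \<in> U. v \<in> e} = e" by (auto simp: edges_in_def)
      then show "card {v \<in> U. v \<in> e} = 2" using e G by (auto simp: edges_in_def fin_graph_def)
    qed
  qed
  finally show ?thesis .
qed

definition locally_sparse :: "'a ugraph \<Rightarrow> real \<Rightarrow> real \<Rightarrow> bool" where
  "locally_sparse G K \<epsilon> \<longleftrightarrow>
     (\<forall>v. \<forall>U\<subseteq>nbhd G v. card (edges_in G U) \<le> K * real (card U) powr (2 - \<epsilon>))"

text \<open>Only the power 1 - \<epsilon> of the size is replaced by its bound in D; the remaining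
  factor \<open>card U\<close> stays linear, so the estimate can be summed over many sets.\<close>

lemma locally_sparseD:
  fixes D K \<epsilon> :: real
  assumes "locally_sparse G K \<epsilon>" "U \<subseteq> nbhd G v" "K \<ge> 0" "\<epsilon> \<le> 1" "card U \<le> D"
  shows "card (edges_in G U) \<le> card U * (K * D powr (1 - \<epsilon>))"
proof -
  have "real (card U) powr (2 - \<epsilon>) = card U * real (card U) powr (1 - \<epsilon>)"
    using powr_add[of "card U" 1 "1 - \<epsilon>"] by simp
  moreover have "real (card U) powr (1 - \<epsilon>) \<le> D powr (1 - \<epsilon>)"
    using assms by (intro powr_mono2) auto
  ultimately have "K * real (card U) powr (2 - \<epsilon>) \<le> K * (card U * D powr (1 - \<epsilon>))"
    using assms(3) by (auto intro!: mult_left_mono)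
  moreover have "card (edges_in G U) \<le> K * real (card U) powr (2 - \<epsilon>)"
    using assms(1,2) unfolding locally_sparse_def by blast
  ultimately show ?thesis by (simp only: mult_ac)
qed

lemma sp_degenerate_ge:
  fixes D K \<epsilon> :: real
  assumes G: "fin_graph G" and sparse: "locally_sparse G K \<epsilon>"
    and K: "K \<ge> 1" and \<epsilon>: "\<epsilon> \<le> 1 / 2" and D: "D \<ge> 1"
    and deg: "\<And>W. W \<subseteq> verts G \<Longrightarrow> W \<noteq> {} \<Longrightarrow> \<exists>w\<in>W. card (nbhd G w \<inter> W) < D"
  shows "card (edges G) * D powr (\<epsilon> - 1) / (128 * K) \<le> sp G"
proof -
  define V where "V = verts G"
  define m where "m = real (card (edges G))"
  have finV: "finite V" using G by (simp add: V_def fin_graph_def)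
  obtain r :: "'a \<Rightarrow> nat" where r: "inj_on r V" and
      rdeg: "\<forall>v\<in>V. card {u \<in> nbhd G v \<inter> V. r u < r v} < D"
    using exists_degenerate_rank[OF G deg, of V] by (auto simp: V_def)
  define N where "N v = {u \<in> nbhd G v. r u < r v}" for v
  have NV: "N v \<subseteq> V" for v using nbhd_subset[OF G] by (auto simp: N_def V_def)
  then have "{u \<in> nbhd G v \<inter> V. r u < r v} = N v" for v by (auto simp: N_def)
  with rdeg have cN: "card (N v) < D" if "v \<in> V" for v using that by auto
  \<comment> \<open>With this choice \<gamma> K D^(1 - \<epsilon>) = 1/4, so the triangles cost half
    of the gain \<gamma> m / 2. Since \<epsilon> \<le> 1/2, \<gamma>^2 D is also bounded, as the
    gain estimate demands.\<close>
  define \<gamma> where "\<gamma> = D powr (\<epsilon> - 1) / (4 * K)"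
  have \<gamma>0: "0 < \<gamma>" using K D by (simp add: \<gamma>_def)
  have "D powr (\<epsilon> - 1) \<le> D powr 0" using D \<epsilon> by (intro powr_mono) auto
  then have "D powr (\<epsilon> - 1) \<le> 1" using D by simp
  then have \<gamma>half: "\<gamma> \<le> 1 / 2" unfolding \<gamma>_def using K by (simp add: field_simps)
  have \<gamma>D: "8 * \<gamma>\<^sup>2 * D \<le> 1"
  proof -
    have "(D powr (\<epsilon> - 1))\<^sup>2 * D = D powr (2 * \<epsilon> - 1)"
    proof -
      have "(D powr (\<epsilon> - 1))\<^sup>2 * D = D powr (\<epsilon> - 1) * D powr (\<epsilon> - 1) * D powr 1"
        unfolding power2_eq_square using D by (subst powr_one) auto
      also have "\<dots> = D powr (\<epsilon> - 1 + (\<epsilon> - 1) + 1)" by (simp only: powr_add)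
      also have "\<epsilon> - 1 + (\<epsilon> - 1) + 1 = 2 * \<epsilon> - 1" by simp
      finally show ?thesis .
    qed
    also have "\<dots> \<le> D powr 0" using D \<epsilon> by (intro powr_mono) auto
    finally have le1: "(D powr (\<epsilon> - 1))\<^sup>2 * D \<le> 1" using D by simp
    have "1 \<le> K\<^sup>2" using K by simp
    have "8 * \<gamma>\<^sup>2 * D = (D powr (\<epsilon> - 1))\<^sup>2 * D / (2 * K\<^sup>2)"
      by (simp add: \<gamma>_def power_divide power_mult_distrib)
    also have "\<dots> \<le> 1" using le1 \<open>1 \<le> K\<^sup>2\<close> by (simp add: divide_le_eq)
    finally show ?thesis .
  qed
  define x where "x A w = (sg A w - clip (\<gamma> * ssum (N w) A)) / 2" for A w
  have edge_sum: "(\<Sum>e\<in>edges_in G U. f e) = (\<Sum>v\<in>U. \<Sum>u\<in>N v \<inter> U. f {u, v})"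
    if "U \<subseteq> V" for U and f :: "'a set \<Rightarrow> real"
    using sum_edges_in_orientation[OF G] r that by (simp add: N_def V_def)
  have m: "m = (\<Sum>v\<in>V. real (card (N v)))"
    using edge_sum[of V "\<lambda>e. 1"] NV by (simp add: m_def edges_in_verts[OF G] V_def Int_absorb2)
  \<comment> \<open>For fixed \<open>v\<close> the inner sum counts the edges inside
    \<open>N v\<close>, that is, the triangles whose latest vertex is \<open>v\<close>; local
    sparsity applies to \<open>N v\<close>.\<close>
  have triangles: "(\<Sum>v\<in>V. \<Sum>u\<in>N v. real (card (N u \<inter> N v))) \<le> K * D powr (1 - \<epsilon>) * m"
  proof -
    have "(\<Sum>u\<in>N v. real (card (N u \<inter> N v))) \<le> card (N v) * (K * D powr (1 - \<epsilon>))" if "v \<in> V" for v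
    proof -
      have "(\<Sum>u\<in>N v. real (card (N u \<inter> N v))) = card (edges_in G (N v))"
        using edge_sum[of "N v" "\<lambda>e. 1"] NV by simp
      also have "\<dots> \<le> card (N v) * (K * D powr (1 - \<epsilon>))"
        using cN[OF that] K \<epsilon> by (intro locally_sparseD[OF sparse, of _ v]) (auto simp: N_def)
      finally show ?thesis .
    qed
    then have "(\<Sum>v\<in>V. \<Sum>u\<in>N v. real (card (N u \<inter> N v))) \<le> (\<Sum>v\<in>V. card (N v) * (K * D powr (1 - \<epsilon>)))"
      by (intro sum_mono)
    also have "\<dots> = K * D powr (1 - \<epsilon>) * m"
      by (simp add: m sum_distrib_right[symmetric])
    finally show ?thesis .
  qed
  have "(\<Sum>e\<in>edges G. avg V (\<lambda>A. \<Prod>w\<in>e. x A w)) = (\<Sum>v\<in>V. \<Sum>u\<in>N v. avg V (\<lambda>A. \<Prod>w\<in>{u, v}. x A w))"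
    using edge_sum[of V] NV by (simp add: edges_in_verts[OF G] V_def Int_absorb2)
  also have "\<dots> \<le> (\<Sum>v\<in>V. \<Sum>u\<in>N v. (\<gamma>\<^sup>2 * card (N u \<inter> N v) - \<gamma> / 2) / 4)"
  proof (intro sum_mono)
    fix v u assume v: "v \<in> V" and u: "u \<in> N v"
    then have "u \<noteq> v" "v \<notin> N u" by (auto simp: N_def)
    have "8 * \<gamma>\<^sup>2 * card (N v) \<le> 8 * \<gamma>\<^sup>2 * D" using cN[OF v] by (intro mult_left_mono) auto
    then have "8 * \<gamma>\<^sup>2 * card (N v) \<le> 1" using \<gamma>D by linarith
    then have "avg V (\<lambda>A. x A u * x A v) \<le> (\<gamma>\<^sup>2 * card (N u \<inter> N v) - \<gamma> / 2) / 4"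
      unfolding x_def using \<gamma>0 \<gamma>half v u \<open>u \<noteq> v\<close> \<open>v \<notin> N u\<close> finV NV
      by (intro avg_orientation_edge_le) auto
    then show "avg V (\<lambda>A. \<Prod>w\<in>{u, v}. x A w) \<le> (\<gamma>\<^sup>2 * card (N u \<inter> N v) - \<gamma> / 2) / 4"
      using \<open>u \<noteq> v\<close> by simp
  qed
  also have "\<dots> = (\<gamma>\<^sup>2 * (\<Sum>v\<in>V. \<Sum>u\<in>N v. real (card (N u \<inter> N v))) - \<gamma> / 2 * m) / 4"
    by (simp add: m sum_subtractf sum_divide_distrib[symmetric] sum_distrib_left[symmetric]
        sum_distrib_right[symmetric] mult.commute)
  also have "\<dots> \<le> (\<gamma>\<^sup>2 * (K * D powr (1 - \<epsilon>) * m) - \<gamma> / 2 * m) / 4"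
    using triangles by (intro divide_right_mono diff_right_mono mult_left_mono) auto
  also have "\<gamma>\<^sup>2 * (K * D powr (1 - \<epsilon>) * m) = \<gamma> * m / 4"
  proof -
    have "D powr (\<epsilon> - 1) * D powr (1 - \<epsilon>) = 1" using D by (simp flip: powr_add)
    then have "\<gamma> * (K * D powr (1 - \<epsilon>)) = 1 / 4" using K by (simp add: \<gamma>_def field_simps)
    then show ?thesis by (simp add: power2_eq_square)
  qed
  finally have "(\<Sum>e\<in>edges G. avg V (\<lambda>A. \<Prod>w\<in>e. x A w)) \<le> - \<gamma> * m / 16"
    by simp
  moreover have "\<bar>x A w\<bar> \<le> 1" for A w
    using abs_clip_le[of "\<gamma> * ssum (N w) A"] by (auto simp: x_def sg_def abs_if split: if_splits)
  then have "- (\<Sum>e\<in>edges G. avg V (\<lambda>A. \<Prod>w\<in>e. x A w)) / 2 \<le> sp G"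
    by (intro sp_ge_avg_relaxation G finV)
  ultimately have "\<gamma> * m / 32 \<le> sp G" by simp
  then show ?thesis by (simp add: \<gamma>_def m_def mult_ac)
qed

subsection \<open>Graphs with a subgraph of large minimum degree\<close>

text \<open>If some vertex had s neighbours in W outside the union of a maximal family, these would
  form a further member.\<close>

lemma exists_maximal_packing:
  assumes G: "fin_graph G" and W: "W \<subseteq> verts G" and s: "1 \<le> s"
  obtains \<P> where "finite \<P>" "pairwise disjnt \<P>"
    "\<And>P. P \<in> \<P> \<Longrightarrow> P \<subseteq> W \<and> card P = s \<and> (\<exists>w. P \<subseteq> nbhd G w)"
    "\<And>w. w \<in> W \<Longrightarrow> card (nbhd G w \<inter> (W - \<Union>\<P>)) < s"
proof -
  have finW: "finite W" using W finite_verts[OF G] finite_subset by blast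
  let ?good = "\<lambda>P. P \<subseteq> W \<and> card P = s \<and> (\<exists>w. P \<subseteq> nbhd G w)"
  define F where "F = {\<P>. pairwise disjnt \<P> \<and> (\<forall>P\<in>\<P>. ?good P)}"
  have "finite F"
    by (rule finite_subset[of _ "Pow (Pow W)"]) (auto simp: F_def finW)
  moreover have "{} \<in> F" by (simp add: F_def pairwise_def disjnt_def)
  ultimately obtain \<P> where \<P>: "\<P> \<in> F" and max: "\<And>\<Q>. \<Q> \<in> F \<Longrightarrow> \<P> \<subseteq> \<Q> \<Longrightarrow> \<Q> = \<P>"
    using finite_has_maximal[of F] by (metis empty_iff)
  have "card (nbhd G w \<inter> (W - \<Union>\<P>)) < s" for w
  proof (rule ccontr)
    assume "\<not> ?thesis"
    then obtain Q where Q: "Q \<subseteq> nbhd G w \<inter> (W - \<Union>\<P>)" "card Q = s"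
      by (meson not_less obtain_subset_with_card_n)
    \<comment> \<open>Being disjoint from the union, Q could already be a member only if it were
      empty, which s \<ge> 1 excludes.\<close>
    have "Q \<noteq> {}" using Q(2) s by auto
    then have "Q \<notin> \<P>" using Q(1) by auto
    moreover have "insert Q \<P> \<in> F"
      using \<P> Q by (auto simp: F_def pairwise_def disjnt_def)
    ultimately show False using max by blast
  qed
  moreover have "finite \<P>"
    by (rule finite_subset[of _ "Pow W"]) (use \<P> finW in \<open>auto simp: F_def\<close>)
  ultimately show thesis using that[of \<P>] \<P> by (auto simp: F_def)
qed

text \<open>Subtracting the mean of k signs gives every pair of distinct signs covariance -1/k; the
  factor 1/2 in \<open>c\<close>, which keeps the values in [-1, 1], accounts for the division by
  4.\<close>

lemma avg_part_pair:
  assumes fin: "finite I" and p: "p \<in> I" and q: "q \<in> I"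
  defines "c \<equiv> \<lambda>A i. (sg A i - ssum I A / card I) / 2"
  shows "avg I (\<lambda>A. c A p * c A q) = ((if p = q then 1 else 0) - 1 / card I) / 4"
proof -
  define k where "k = real (card I)"
  have k: "k > 0" using fin p by (auto simp: k_def card_gt_0_iff)
  have "avg I (\<lambda>A. c A p * c A q) = avg I (\<lambda>A. (1/4) * (sg A p * sg A q
      - (1/k) * (sg A p * ssum I A) - (1/k) * (sg A q * ssum I A) + (1/k\<^sup>2) * (ssum I A)\<^sup>2))"
    using k by (intro avg_cong) (simp add: c_def k_def[symmetric] field_simps power2_eq_square)
  also have "\<dots> = (1/4) * (avg I (\<lambda>A. sg A p * sg A q) - (1/k) * avg I (\<lambda>A. sg A p * ssum I A)
      - (1/k) * avg I (\<lambda>A. sg A q * ssum I A) + (1/k\<^sup>2) * avg I (\<lambda>A. (ssum I A)\<^sup>2))"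
    by (simp only: avg_cmult avg_add avg_diff)
  also have "\<dots> = ((if p = q then 1 else 0) - 1 / k) / 4"
    using k by (simp add: avg_sg_sg avg_sg_ssum avg_ssum_square fin p q k_def[symmetric])
      (simp add: field_simps power2_eq_square)
  finally show ?thesis by (simp add: k_def)
qed

text \<open>Vertices of a part share its centred sign and all other vertices get 0. Each edge within
  the union contributes -1/(4k), plus 1/4 if it lies inside a part; every other edge has an endpoint
  of value 0.\<close>

lemma sp_packing_ge:
  assumes G: "fin_graph G" and fin: "finite \<P>" and disj: "pairwise disjnt \<P>"
    and sub: "\<And>P. P \<in> \<P> \<Longrightarrow> P \<subseteq> verts G"
  shows "(card (edges_in G (\<Union>\<P>)) / card \<P> - (\<Sum>P\<in>\<P>. card (edges_in G P))) / 8 \<le> sp G"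
proof -
  let ?U = "\<Union>\<P>" and ?k = "real (card \<P>)"
  define part where "part v = (SOME P. P \<in> \<P> \<and> v \<in> P)" for v
  have part: "part v \<in> \<P>" "v \<in> part v" if "v \<in> ?U" for v
    using someI_ex[of "\<lambda>P. P \<in> \<P> \<and> v \<in> P"] that by (auto simp: part_def)
  define c where "c A P = (sg A P - ssum \<P> A / card \<P>) / 2" for A P
  define x where "x A v = (if v \<in> ?U then c A (part v) else 0)" for A v
  have "\<bar>c A P\<bar> \<le> 1" for A P
  proof -
    have "\<bar>ssum \<P> A\<bar> \<le> (\<Sum>P\<in>\<P>. \<bar>sg A P\<bar>)" unfolding ssum_def by (rule sum_abs)
    also have "\<dots> = (\<Sum>P\<in>\<P>. 1)" by (intro sum.cong) (auto simp: sg_def)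
    also have "\<dots> = ?k" by simp
    finally have "\<bar>ssum \<P> A / ?k\<bar> \<le> 1" by (simp add: divide_le_eq)
    then show ?thesis unfolding c_def sg_def by (auto simp: abs_if split: if_splits)
  qed
  then have "\<bar>x A v\<bar> \<le> 1" for A v by (simp add: x_def)
  then have "- (\<Sum>e\<in>edges G. avg \<P> (\<lambda>A. \<Prod>w\<in>e. x A w)) / 2 \<le> sp G"
    by (intro sp_ge_avg_relaxation G fin)
  moreover have "(\<Sum>e\<in>edges G. avg \<P> (\<lambda>A. \<Prod>w\<in>e. x A w))
      \<le> ((\<Sum>P\<in>\<P>. card (edges_in G P)) - card (edges_in G ?U) / ?k) / 4"
  proof -
    let ?inner = "{e \<in> edges_in G ?U. \<exists>P\<in>\<P>. e \<subseteq> P}"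
    have "(\<Sum>e\<in>edges G. avg \<P> (\<lambda>A. \<Prod>w\<in>e. x A w)) = (\<Sum>e\<in>edges_in G ?U. avg \<P> (\<lambda>A. \<Prod>w\<in>e. x A w))"
    proof (rule sum.mono_neutral_right)
      show "\<forall>e\<in>edges G - edges_in G ?U. avg \<P> (\<lambda>A. \<Prod>w\<in>e. x A w) = 0"
      proof
        fix e assume e: "e \<in> edges G - edges_in G ?U"
        then have e': "e \<in> edges G" by simp
        obtain u v where uv: "e = {u, v}" "u \<noteq> v" using edgeE[OF G e'] .
        then have "u \<notin> ?U \<or> v \<notin> ?U" using e by (auto simp: edges_in_def)
        then have "x A u = 0 \<or> x A v = 0" for A by (auto simp: x_def)
        then have "(\<Prod>w\<in>e. x A w) = 0" for A using uv by simp
        then show "avg \<P> (\<lambda>A. \<Prod>w\<in>e. x A w) = 0" by (simp add: avg_def)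
      qed
    qed (auto simp: edges_in_def finite_edges[OF G])
    also have "\<dots> = (\<Sum>e\<in>edges_in G ?U. (if e \<in> ?inner then 1 / 4 else 0) - 1 / ?k / 4)"
    proof (intro sum.cong refl)
      fix e assume e: "e \<in> edges_in G ?U"
      then have e': "e \<in> edges G" by (simp add: edges_in_def)
      obtain u v where uv: "e = {u, v}" "u \<noteq> v" using edgeE[OF G e'] .
      then have U: "u \<in> ?U" "v \<in> ?U" using e by (auto simp: edges_in_def)
      have inner: "e \<in> ?inner \<longleftrightarrow> part u = part v"
      proof
        assume "e \<in> ?inner"
        then obtain P where P: "P \<in> \<P>" "u \<in> P" "v \<in> P" using uv by auto
        then have "part u = P" "part v = P"
          using part[OF U(1)] part[OF U(2)] disj unfolding pairwise_def disjnt_def by blast+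
        then show "part u = part v" by simp
      next
        assume "part u = part v"
        then show "e \<in> ?inner" using part[OF U(1)] part[OF U(2)] uv e by auto
      qed
      have "avg \<P> (\<lambda>A. \<Prod>w\<in>e. x A w) = avg \<P> (\<lambda>A. c A (part u) * c A (part v))"
        using uv U by (simp add: x_def)
      also have "\<dots> = ((if part u = part v then 1 else 0) - 1 / ?k) / 4"
        unfolding c_def using part U fin by (intro avg_part_pair) auto
      also have "\<dots> = (if e \<in> ?inner then 1 / 4 else 0) - 1 / ?k / 4"
        unfolding inner by (simp add: diff_divide_distrib)
      finally show "avg \<P> (\<lambda>A. \<Prod>w\<in>e. x A w) = (if e \<in> ?inner then 1 / 4 else 0) - 1 / ?k / 4" .
    qed
    also have "\<dots> = card ?inner / 4 - card (edges_in G ?U) * (1 / ?k / 4)"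
      using finite_edges_in[OF G] by (simp add: sum_subtractf sum.If_cases Int_def cong: conj_cong)
    also have "real (card ?inner) \<le> (\<Sum>P\<in>\<P>. card (edges_in G P))"
    proof -
      have "card ?inner \<le> card (\<Union>P\<in>\<P>. edges_in G P)"
        by (intro card_mono finite_UN_I fin finite_edges_in[OF G]) (auto simp: edges_in_def)
      also have "\<dots> \<le> (\<Sum>P\<in>\<P>. card (edges_in G P))" by (rule card_UN_le[OF fin])
      finally show ?thesis by (simp flip: of_nat_sum)
    qed
    finally show ?thesis by (simp add: diff_divide_distrib)
  qed
  ultimately show ?thesis by simp
qed

text \<open>The union U of a maximal packing into k parts of size s about D/2 has k s vertices, each
  with at least D/2 neighbours in U, so e(U)/k is at least of order D^2. The parts contain at most
  \<open>card W\<close> K D^(1 - \<epsilon>) edges altogether, and \<open>card W\<close> \<le> 2m/D;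
  the assumption \<open>large\<close> makes this a smaller multiple of D^2.\<close>

lemma sp_min_degree_ge:
  fixes D K \<epsilon> :: real
  assumes G: "fin_graph G" and sparse: "locally_sparse G K \<epsilon>"
    and K: "K \<ge> 0" and \<epsilon>: "\<epsilon> \<le> 1" and D: "D \<ge> 2"
    and W: "W \<subseteq> verts G" "W \<noteq> {}" and deg: "\<And>w. w \<in> W \<Longrightarrow> D \<le> card (nbhd G w \<inter> W)"
    and large: "64 * K * card (edges G) \<le> D powr (2 + \<epsilon>)"
  shows "D\<^sup>2 / 128 \<le> sp G"
proof -
  \<comment> \<open>Rounding up leaves at most s - 1 < D/2 neighbours outside the packing, hence at
    least D/2 inside; D \<ge> 2 ensures s \<le> D.\<close>
  define s where "s = nat \<lceil>D / 2\<rceil>"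
  have s: "D / 2 \<le> s" "s < D / 2 + 1" using D unfolding s_def by linarith+
  then have "1 \<le> s" "s \<le> D" using D by linarith+
  obtain \<P> where \<P>: "finite \<P>" "pairwise disjnt \<P>"
    "\<And>P. P \<in> \<P> \<Longrightarrow> P \<subseteq> W \<and> card P = s \<and> (\<exists>w. P \<subseteq> nbhd G w)"
    "\<And>w. w \<in> W \<Longrightarrow> card (nbhd G w \<inter> (W - \<Union>\<P>)) < s"
    using exists_maximal_packing[OF G W(1) \<open>1 \<le> s\<close>] by blast
  let ?U = "\<Union>\<P>" and ?k = "card \<P>"
  have UW: "?U \<subseteq> W" using \<P>(3) by blast
  have finW: "finite W" using W finite_verts[OF G] finite_subset by blast
  have degU: "D / 2 \<le> card (nbhd G w \<inter> ?U)" if w: "w \<in> W" for w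
  proof -
    have "card (nbhd G w \<inter> W) \<le> card (nbhd G w \<inter> ?U) + card (nbhd G w \<inter> (W - ?U))"
      using finW UW finite_subset[OF UW finW]
      by (intro order.trans[OF card_mono card_Un_le]) auto
    then show ?thesis using deg[OF w] \<P>(4)[OF w] s(2) by linarith
  qed
  have k: "?k \<noteq> 0"
  proof
    assume "?k = 0"
    then have "\<P> = {}" using \<P>(1) by simp
    then have "D / 2 \<le> 0" if "w \<in> W" for w using degU[OF that] by simp
    then show False using D W(2) by auto
  qed
  have cU: "card ?U = ?k * s"
  proof -
    have "card ?U = (\<Sum>P\<in>\<P>. card P)"
      using \<P>(2,3) finite_subset[OF _ finW] by (intro card_Union_disjoint) auto
    then show ?thesis using \<P>(3) by simp
  qed
  have "card ?U * (D / 2) \<le> (\<Sum>v\<in>?U. real (card (nbhd G v \<inter> ?U)))"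
    using degU UW sum_bounded_below[of ?U "D / 2" "\<lambda>v. real (card (nbhd G v \<inter> ?U))"] by auto
  also have "\<dots> = 2 * card (edges_in G ?U)"
    using sum_degrees[OF G, of ?U] UW W by (simp flip: of_nat_sum)
  finally have "?k * (s * (D / 4)) \<le> card (edges_in G ?U)" unfolding cU by simp
  then have "s * (D / 4) \<le> card (edges_in G ?U) / ?k"
    using k by (simp add: pos_le_divide_eq mult.commute)
  moreover have "D / 2 * (D / 4) \<le> s * (D / 4)" using s D by (intro mult_right_mono) auto
  ultimately have "D / 2 * (D / 4) \<le> card (edges_in G ?U) / ?k" by linarith
  then have outer: "D\<^sup>2 / 8 \<le> card (edges_in G ?U) / ?k"
    by (simp add: power2_eq_square)
  have cW: "card W * D \<le> 2 * card (edges G)"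
  proof -
    have "card W * D \<le> (\<Sum>v\<in>W. real (card (nbhd G v \<inter> W)))"
      using deg sum_bounded_below[of W D "\<lambda>v. real (card (nbhd G v \<inter> W))"] by auto
    also have "\<dots> = 2 * card (edges_in G W)" using sum_degrees[OF G W(1)] by (simp flip: of_nat_sum)
    also have "\<dots> \<le> 2 * card (edges G)" using card_edges_in_le[OF G] by simp
    finally show ?thesis .
  qed
  have "(\<Sum>P\<in>\<P>. real (card (edges_in G P))) \<le> (\<Sum>P\<in>\<P>. s * (K * D powr (1 - \<epsilon>)))"
  proof (intro sum_mono)
    fix P assume "P \<in> \<P>"
    then obtain w where "P \<subseteq> nbhd G w" "card P = s" using \<P>(3) by blast
    then show "card (edges_in G P) \<le> s * (K * D powr (1 - \<epsilon>))"
      using locally_sparseD[OF sparse _ K \<epsilon>, of P w D] \<open>s \<le> D\<close> by simp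
  qed
  also have "\<dots> = card ?U * (K * D powr (1 - \<epsilon>))" by (simp add: cU)
  also have "\<dots> \<le> card W * (K * D powr (1 - \<epsilon>))"
    using card_mono[OF finW UW] K by (intro mult_right_mono) auto
  also have "\<dots> = (card W * D) * (K * D powr (- \<epsilon>))"
    using D powr_add[of D 1 "- \<epsilon>"] by simp
  also have "\<dots> \<le> (2 * card (edges G)) * (K * D powr (- \<epsilon>))"
    using cW K by (intro mult_right_mono) auto
  also have "\<dots> = (64 * K * card (edges G)) * D powr (- \<epsilon>) / 32" by simp
  also have "\<dots> \<le> D powr (2 + \<epsilon>) * D powr (- \<epsilon>) / 32"
    using large by (intro divide_right_mono mult_right_mono) auto
  also have "D powr (2 + \<epsilon>) * D powr (- \<epsilon>) = D\<^sup>2"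
    using D by (simp flip: powr_add)
  finally have inner: "(\<Sum>P\<in>\<P>. real (card (edges_in G P))) \<le> D\<^sup>2 / 32" .
  \<comment> \<open>(1/8 - 1/32) / 8 = 3/256, which exceeds 1/128.\<close>
  have "D\<^sup>2 / 128 \<le> (D\<^sup>2 / 8 - D\<^sup>2 / 32) / 8" by simp
  also have "\<dots> \<le> (card (edges_in G ?U) / ?k - (\<Sum>P\<in>\<P>. card (edges_in G P))) / 8"
    using inner outer unfolding of_nat_sum by (intro divide_right_mono diff_mono) simp_all
  also have "\<dots> \<le> sp G"
    using \<P> W by (intro sp_packing_ge G) blast+
  finally show ?thesis .
qed

subsection \<open>Locally sparse graphs from a forbidden subgraph\<close>

text \<open>A copy of \<open>del_vert H v\<close> inside U would extend to a copy of H by sending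
  \<open>v\<close> to \<open>x\<close>, which is adjacent to all of U.\<close>

lemma card_edges_in_nbhd_le_ex_num:
  fixes G :: "nat ugraph" and H :: "'a ugraph"
  assumes G: "fin_graph G" and H: "fin_graph H" "v \<in> verts H" and free: "\<not> has_copy G H"
    and U: "U \<subseteq> nbhd G x"
  shows "card (edges_in G U) \<le> ex_num (card U) (del_vert H v)"
proof (cases "U = {}")
  case True
  then have "edges_in G U = {}" using G by (auto simp: edges_in_def fin_graph_def)
  then show ?thesis by simp
next
  case False
  then have x: "x \<in> verts G" using U nbhd_sym[of _ G x] nbhd_subset[OF G] by blast
  let ?B = "del_vert H v" and ?GU = "\<lparr>verts = U, edges = edges_in G U\<rparr>"
  have finU: "finite U" using U finite_nbhd[OF G] finite_subset by blast
  have GU: "fin_graph ?GU" using G finU by (auto simp: fin_graph_def edges_in_def)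
  have "\<not> has_copy ?GU ?B"
  proof
    assume "has_copy ?GU ?B"
    then obtain f where f: "inj_on f (verts H - {v})" "f ` (verts H - {v}) \<subseteq> U"
        "\<And>e. e \<in> edges H \<Longrightarrow> v \<notin> e \<Longrightarrow> f ` e \<in> edges_in G U"
      by (auto simp: has_copy_def del_vert_def)
    have "x \<notin> U" using U not_in_nbhd[OF G] by blast
    have "inj_on (f(v := x)) (verts H)"
      using f(1,2) \<open>x \<notin> U\<close> by (auto simp: inj_on_def image_subset_iff)
    moreover have "f(v := x) ` verts H \<subseteq> verts G"
      using f(2) U nbhd_subset[OF G, of x] x by (auto simp: image_subset_iff)
    moreover have "f(v := x) ` e \<in> edges G" if e: "e \<in> edges H" for e
    proof (cases "v \<in> e")
      case False
      then have "f(v := x) ` e = f ` e" by auto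
      then show ?thesis using f(3)[OF e False] by (simp add: edges_in_def)
    next
      case True
      obtain a b where "e = {a, b}" "a \<noteq> b" "a \<in> verts H" "b \<in> verts H" using edgeE[OF H(1) e] .
      then obtain w where w: "e = {w, v}" "w \<noteq> v" "w \<in> verts H" using True by auto
      then have "f w \<in> nbhd G x" using f(2) U by blast
      then show ?thesis using w by (simp add: nbhd_def)
    qed
    ultimately have "has_copy G H" unfolding has_copy_def by blast
    then show False using free by blast
  qed
  then have "card (edges_in G U) \<in> {card (edges G) | G :: nat ugraph.
      fin_graph G \<and> card (verts G) = card U \<and> \<not> has_copy G ?B}"
    using GU by (intro CollectI exI[of _ ?GU]) auto
  \<comment> \<open>A supremum of naturals dominates the members only of a bounded set; on n
    vertices the edges are among 2^n subsets.\<close>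
  moreover have "bdd_above {card (edges G) | G :: nat ugraph.
      fin_graph G \<and> card (verts G) = n \<and> \<not> has_copy G ?B}" for n
  proof (rule bdd_aboveI)
    fix j assume "j \<in> {card (edges G) | G :: nat ugraph.
      fin_graph G \<and> card (verts G) = n \<and> \<not> has_copy G ?B}"
    then obtain G' :: "nat ugraph" where G': "fin_graph G'" "card (verts G') = n" "j = card (edges G')" by auto
    then have "card (edges G') \<le> card (Pow (verts G'))"
      by (intro card_mono) (auto simp: fin_graph_def)
    also have "\<dots> = 2 ^ n" using G' by (simp add: card_Pow finite_verts)
    finally show "j \<le> 2 ^ n" using G' by simp
  qed
  ultimately show ?thesis unfolding ex_num_def by (rule cSup_upper)
qed

text \<open>The finitely many n below the asymptotic range are absorbed into K, since n^(2 -
  \<epsilon>) \<ge> 1 for n \<ge> 1. The separate exponent a allows \<epsilon> to be lowered at the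
  same time.\<close>

lemma bigo_powr_imp_le:
  fixes f :: "nat \<Rightarrow> nat"
  assumes "(\<lambda>n. real (f n)) \<in> O(\<lambda>n. real n powr a)" and "\<epsilon> \<le> 2 - a" "\<epsilon> \<le> 2"
  shows "\<exists>K\<ge>1. \<forall>n\<ge>1. real (f n) \<le> K * real n powr (2 - \<epsilon>)"
proof -
  obtain c where c: "c > 0" "eventually (\<lambda>n. norm (real (f n)) \<le> c * norm (real n powr a)) sequentially"
    using landau_o.bigE[OF assms(1)] by blast
  then obtain n0 where n0: "\<And>n. n \<ge> n0 \<Longrightarrow> real (f n) \<le> c * real n powr a"
    by (auto simp: eventually_sequentially)
  define K where "K = 1 + c + (\<Sum>n<n0. real (f n))"
  have K: "1 \<le> K" "c \<le> K" using c by (auto simp: K_def intro!: add_nonneg_nonneg sum_nonneg)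
  have "real (f n) \<le> K * real n powr (2 - \<epsilon>)" if n: "n \<ge> 1" for n
  proof (cases "n \<ge> n0")
    case True
    have "c * real n powr a \<le> K * real n powr (2 - \<epsilon>)"
      using K n assms(2) c by (intro mult_mono powr_mono) auto
    then show ?thesis using n0[OF True] by linarith
  next
    case False
    then have "real (f n) \<le> (\<Sum>n<n0. real (f n))"
      by (intro member_le_sum) auto
    then have "real (f n) \<le> K" using c by (simp add: K_def)
    also have "\<dots> \<le> K * real n powr (2 - \<epsilon>)"
      using K n assms(3) mult_left_mono[of 1 "real n powr (2 - \<epsilon>)" K]
      by (simp add: ge_one_powr_ge_zero)
    finally show ?thesis .
  qed
  then show ?thesis using K by blast
qed

section \<open>Choice of the constants, and the two cases combined\<close>

theorem theorem2p9:
  fixes \<epsilon> :: real and H :: "'a ugraph" and v :: 'a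
  assumes "2 / 5 < \<epsilon>" and "\<epsilon> \<le> 1"
    and "fin_graph H"
    and "v \<in> verts H"
    and "bipartite (del_vert H v)"
    and "(\<lambda>n. real (ex_num n (del_vert H v))) \<in> O(\<lambda>n. real n powr (2 - \<epsilon>))"
  shows "\<exists>\<epsilon>H > 0. \<exists>C > 0. \<forall>m \<ge> 1.
           ereal (C * real m powr (3 / 4 + \<epsilon>H)) \<le> sp_min m H"
proof -
  \<comment> \<open>The degenerate case requires an exponent of at most 1/2; lowering \<epsilon>
    only weakens the bound on \<open>ex_num\<close>.\<close>
  define \<delta> where "\<delta> = min \<epsilon> (1 / 2)"
  have \<delta>: "2 / 5 < \<delta>" "\<delta> \<le> 1 / 2" "\<delta> \<le> \<epsilon>" using assms(1) by (auto simp: \<delta>_def)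
  obtain K where K: "K \<ge> 1" "\<And>n. n \<ge> 1 \<Longrightarrow> real (ex_num n (del_vert H v)) \<le> K * real n powr (2 - \<delta>)"
    using bigo_powr_imp_le[OF assms(6), of \<delta>] \<delta> by auto
  \<comment> \<open>The degenerate case has exponent 1 + (\<delta> - 1)/(2 + \<delta>) = (1 +
    2\<delta>)/(2 + \<delta>), which exceeds 3/4 exactly for \<delta> > 2/5.\<close>
  define \<eta> where "\<eta> = (1 + 2 * \<delta>) / (2 + \<delta>) - 3 / 4"
  \<comment> \<open>L makes D^(2 + \<delta>) equal to 64 K m, the threshold in
    \<open>sp_min_degree_ge\<close>; C is the smaller of the constants of the two cases.\<close>
  define L where "L = (64 * K) powr (1 / (2 + \<delta>))"
  define C where "C = min (L powr (\<delta> - 1) / (128 * K)) (L\<^sup>2 / 128)"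
  have "\<eta> > 0" unfolding \<eta>_def using \<delta> by (simp add: field_simps)
  have L: "L \<ge> 2"
  proof -
    have "2 powr (2 + \<delta>) \<le> 2 powr (3 :: real)" using \<delta> by (intro powr_mono) auto
    also have "\<dots> \<le> 64 * K" using K by simp
    finally have "(2 powr (2 + \<delta>)) powr (1 / (2 + \<delta>)) \<le> L"
      unfolding L_def using \<delta> by (intro powr_mono2) auto
    then show ?thesis using \<delta> by (simp add: powr_powr)
  qed
  have "C > 0" using L K by (simp add: C_def)
  have bound: "C * real m powr (3 / 4 + \<eta>) \<le> sp G"
    if m: "m \<ge> 1" and G: "fin_graph G" "card (edges G) = m" "\<not> has_copy G H" for m and G :: "nat ugraph"
  proof -
    define D where "D = L * real m powr (1 / (2 + \<delta>))"
    have "1 \<le> real m powr (1 / (2 + \<delta>))" using m \<delta> by (intro ge_one_powr_ge_zero) auto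
    then have "2 * 1 \<le> D" unfolding D_def using L by (intro mult_mono) auto
    then have D: "D \<ge> 2" by simp
    have exponent: "3 / 4 + \<eta> = (1 + 2 * \<delta>) / (2 + \<delta>)" by (simp add: \<eta>_def)
    have sparse: "locally_sparse G K \<delta>"
      unfolding locally_sparse_def
    proof (intro allI impI)
      fix x U assume U: "U \<subseteq> nbhd G x"
      show "card (edges_in G U) \<le> K * real (card U) powr (2 - \<delta>)"
      \<comment> \<open>The bound on \<open>ex_num\<close> starts at n = 1; for empty U both sides
        are 0.\<close>
      proof (cases "card U \<ge> 1")
        case True
        then show ?thesis
          using card_edges_in_nbhd_le_ex_num[OF G(1) assms(3,4) G(3) U] K(2)[OF True] by linarith
      next
        case False
        then have "U = {}" using U finite_nbhd[OF G(1)] finite_subset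
          by (metis One_nat_def Suc_leI card_gt_0_iff)
        then have "edges_in G U = {}" using G(1) by (auto simp: edges_in_def fin_graph_def)
        then show ?thesis using K by simp
      qed
    qed
    show ?thesis
    proof (cases "\<forall>W\<subseteq>verts G. W \<noteq> {} \<longrightarrow> (\<exists>w\<in>W. card (nbhd G w \<inter> W) < D)")
      case True
      have "D powr (\<delta> - 1) = L powr (\<delta> - 1) * real m powr ((\<delta> - 1) / (2 + \<delta>))"
        unfolding D_def using L by (simp add: powr_mult powr_powr)
      moreover have "real m powr (3 / 4 + \<eta>) = real m * real m powr ((\<delta> - 1) / (2 + \<delta>))"
      proof -
        have "3 / 4 + \<eta> = 1 + (\<delta> - 1) / (2 + \<delta>)" unfolding exponent using \<delta> by (simp add: field_simps)
        then show ?thesis using m by (simp add: powr_add)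
      qed
      moreover have "C * real m powr (3 / 4 + \<eta>) \<le> L powr (\<delta> - 1) / (128 * K) * real m powr (3 / 4 + \<eta>)"
        unfolding C_def by (intro mult_right_mono) auto
      moreover have "m * D powr (\<delta> - 1) / (128 * K) \<le> sp G"
        using sp_degenerate_ge[OF G(1) sparse K(1) \<delta>(2), of D] D True G(2) by auto
      ultimately show ?thesis by (simp add: mult_ac)
    next
      case False
      then obtain W where W: "W \<subseteq> verts G" "W \<noteq> {}" "\<And>w. w \<in> W \<Longrightarrow> D \<le> card (nbhd G w \<inter> W)"
        by (meson not_less)
      have "D powr (2 + \<delta>) = 64 * K * m"
        unfolding D_def L_def using K m \<delta> by (simp add: powr_mult powr_powr)
      then have "D\<^sup>2 / 128 \<le> sp G"
        using sp_min_degree_ge[OF G(1) sparse _ _ D W] K \<delta> G(2) by auto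
      moreover have "D\<^sup>2 = L\<^sup>2 * real m powr (2 / (2 + \<delta>))"
        unfolding D_def power_mult_distrib by (simp add: power2_eq_square flip: powr_add)
      \<comment> \<open>Since \<delta> \<le> 1/2, 1 + 2\<delta> \<le> 2, so for m \<ge> 1 this case
        gives at least the exponent of the other.\<close>
      moreover have "C * real m powr (3 / 4 + \<eta>) \<le> L\<^sup>2 / 128 * real m powr (2 / (2 + \<delta>))"
        unfolding exponent C_def using m \<delta> by (intro mult_mono powr_mono divide_right_mono) auto
      ultimately show ?thesis by simp
    qed
  qed
  have "ereal (C * real m powr (3 / 4 + \<eta>)) \<le> sp_min m H" if "m \<ge> 1" for m
    unfolding sp_min_def using bound[OF that] by (intro Inf_greatest) auto
  then show ?thesis using \<open>\<eta> > 0\<close> \<open>C > 0\<close> by blast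
qed

end
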